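(* Let $n$ be a positive integer. For every $A\subseteq\mathbb{Z}_n\setminus\{0\}$ and every integer $t$ with $2\leq t<|A|$, there exists an ordering $(a_1,\ldots,a_k)$ of the elements of $A$ (where $k=|A|$) whose partial sums $s_0,s_1,\ldots,s_k$ are such that the number of pairs $(i,j)$ with $0\leq i<j\leq k$, $j-i\leq t$ and $s_i=s_j$ is less than $t-1$.
   Context: An ordering of $A$ lists each element of $A$ exactly once. For an ordering $(a_1,\ldots,a_k)$ of $A$, the partial sums are $s_0=0$ and $s_i=a_1+\cdots+a_i\in\mathbb{Z}_n$ for $1\leq i\leq k$. *)

theory Defs
  imports "HOL-Number_Theory.Residues" "HOL-Combinatorics.Multiset_Permutations"
begin

text \<open>
  List positions start at 0, so the term \<open>a\<^sub>i\<close> of an ordering \<open>(a\<^sub>1, \<dots>, a\<^sub>k)\<close> is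
  \<open>as ! (i - 1)\<close>, and \<open>s\<^sub>i = a\<^sub>1 + \<cdots> + a\<^sub>i\<close> adds up positions \<open>0, \<dots>, i - 1\<close>. The value is
  only meaningful for \<open>i \<le> length as\<close>.
\<close>

definition partial_sum :: "('a, 'm) ring_scheme \<Rightarrow> 'a list \<Rightarrow> nat \<Rightarrow> 'a" where
  "partial_sum G as i = (\<Oplus>\<^bsub>G\<^esub>j\<in>{..<i}. as ! j)"

definition close_collisions ::
    "('a, 'm) ring_scheme \<Rightarrow> nat \<Rightarrow> 'a list \<Rightarrow> (nat \<times> nat) set" where
  "close_collisions G t as =
     {(i, j). i < j \<and> j \<le> length as \<and> j - i \<le> t \<and> partial_sum G as i = partial_sum G as j}"

end

theory Submission
  imports Defs
begin

text \<open>
  In a uniformly random ordering of \<open>A\<close>, a given window of \<open>d\<close> consecutive entries has sum zero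
  with probability at most \<open>1 / (k - d + 1)\<close>, because its first \<open>d - 1\<close> entries determine the last
  one. There are \<open>k - d + 1\<close> windows of length \<open>d\<close>, and none of length 1 has sum zero, so the
  expected number of collisions is at most \<open>t - 1\<close>. Equality for \<open>d = 2\<close> forces \<open>- a \<in> A\<close> and
  \<open>- a \<noteq> a\<close> for all \<open>a \<in> A\<close>. Then equality fails for \<open>d = 3\<close>, because no third entry completes
  \<open>a, - a\<close> to a zero sum. If \<open>t = 2\<close>, an ordering beginning with \<open>a, - a, b, - b\<close> has two
  collisions, so some other ordering lies strictly below the average.
\<close>

section \<open>Windows of an ordering and exchanges of its entries\<close>

definition window_sum :: "('a, 'm) ring_scheme \<Rightarrow> 'a list \<Rightarrow> nat \<Rightarrow> nat \<Rightarrow> 'a" where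
  "window_sum G as i d = (\<Oplus>\<^bsub>G\<^esub>j\<in>{i..<i + d}. as ! j)"

text \<open>Probabilities are replaced by counts: for finite \<open>A\<close>, dividing the
  cardinality by \<open>fact (card A)\<close> gives the probability of a zero sum at this
  window.\<close>

definition zero_windows :: "('a, 'm) ring_scheme \<Rightarrow> 'a set \<Rightarrow> nat \<Rightarrow> nat \<Rightarrow> 'a list set" where
  "zero_windows G A i d = {as \<in> permutations_of_set A. window_sum G as i d = \<zero>\<^bsub>G\<^esub>}"

text \<open>The case \<open>p = q\<close> is allowed and changes nothing; the exchange argument
  includes it.\<close>

definition swap_nth :: "'a list \<Rightarrow> nat \<Rightarrow> nat \<Rightarrow> 'a list" where
  "swap_nth as p q = as[p := as ! q, q := as ! p]"

lemma length_swap_nth [simp]: "length (swap_nth as p q) = length as"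
  by (simp add: swap_nth_def)

lemma swap_nth_swap_nth:
  "p < length as \<Longrightarrow> q < length as \<Longrightarrow> swap_nth (swap_nth as p q) p q = as"
  by (auto simp: swap_nth_def nth_list_update intro!: nth_equalityI)

lemma swap_nth_permutations_of_set:
  assumes "as \<in> permutations_of_set A" "p < length as" "q < length as"
  shows "swap_nth as p q \<in> permutations_of_set A"
  using assms by (auto simp: swap_nth_def permutations_of_set_def distinct_swap set_swap)

text \<open>Supplies the orderings with prescribed first entries that witness strict
  inequalities.\<close>

lemma permutations_of_set_extend:
  assumes "finite A" "set xs \<subseteq> A" "distinct xs"
  obtains ys where "xs @ ys \<in> permutations_of_set A"
proof -
  obtain ys where "set ys = A - set xs" "distinct ys"
    using finite_distinct_list[of "A - set xs"] assms(1) by blast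
  then show thesis
    using assms by (intro that[of ys]) (auto simp: permutations_of_set_def)
qed

lemma card_Collect_eq_sum:
  "finite A \<Longrightarrow> card {x \<in> A. P x} = (\<Sum>x\<in>A. of_bool (P x))"
  by (simp only: of_bool_def card_eq_sum sum.inter_filter)

section \<open>Collisions as zero windows\<close>

context abelian_group
begin

lemma window_sum_closed:
  assumes "set as \<subseteq> carrier G" "i + d \<le> length as"
  shows "window_sum G as i d \<in> carrier G"
  unfolding window_sum_def using assms by (intro finsum_closed) (auto simp: subset_iff)

lemma window_sum_0 [simp]: "window_sum G as i 0 = \<zero>"
  by (simp add: window_sum_def)

lemma window_sum_Suc:
  assumes "set as \<subseteq> carrier G" "i + d < length as"
  shows "window_sum G as i (Suc d) = as ! (i + d) \<oplus> window_sum G as i d"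
proof -
  have "{i..<i + Suc d} = insert (i + d) {i..<i + d}"
    by auto
  then show ?thesis
    using assms by (auto simp: window_sum_def subset_iff intro!: finsum_insert)
qed

lemma window_sum_cong:
  assumes "set as \<subseteq> carrier G" "i + d \<le> length as"
    and "\<And>j. i \<le> j \<Longrightarrow> j < i + d \<Longrightarrow> bs ! j = as ! j"
  shows "window_sum G bs i d = window_sum G as i d"
  unfolding window_sum_def using assms by (intro finsum_cong') (auto simp: subset_iff)

lemma partial_sum_add:
  assumes "set as \<subseteq> carrier G" "i + d \<le> length as"
  shows "partial_sum G as (i + d) = partial_sum G as i \<oplus> window_sum G as i d"
proof -
  have "{..<i + d} = {..<i} \<union> {i..<i + d}"
    by auto
  then show ?thesis
    using assms by (auto simp: partial_sum_def window_sum_def subset_iff intro!: finsum_Un_disjoint)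
qed

lemma partial_sum_eq_iff:
  assumes "set as \<subseteq> carrier G" "i + d \<le> length as"
  shows "partial_sum G as i = partial_sum G as (i + d) \<longleftrightarrow> window_sum G as i d = \<zero>"
proof -
  have "partial_sum G as i \<in> carrier G"
    unfolding partial_sum_def using assms by (intro finsum_closed) (auto simp: subset_iff)
  then show ?thesis
    using partial_sum_add[OF assms] window_sum_closed[OF assms]
    by (metis add.l_cancel_one add.m_closed)
qed

lemma zero_window_pair_iff:
  assumes "set as \<subseteq> carrier G" "i + 2 \<le> length as"
  shows "window_sum G as i 2 = \<zero> \<longleftrightarrow> as ! Suc i = \<ominus> (as ! i)"
proof -
  have c: "as ! i \<in> carrier G" "as ! Suc i \<in> carrier G"
    using assms by (auto simp: subset_iff)
  have "window_sum G as i 2 = as ! Suc i \<oplus> as ! i"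
    using window_sum_Suc[OF assms(1), of i 1] window_sum_Suc[OF assms(1), of i 0] assms(2) c
    by (simp add: numeral_2_eq_2)
  then show ?thesis
    using c by (metis minus_equality l_neg)
qed

text \<open>A collision \<open>(i, j)\<close> is a zero window at \<open>i\<close> of length
  \<open>d = j - i\<close>. Length 1 would make an entry zero, so the sum starts at 2. As
  \<open>d \<le> t \<le> card A\<close>, the difference \<open>card A - d\<close> is not
  truncated.\<close>

lemma card_close_collisions:
  assumes as: "as \<in> permutations_of_set A" and A: "A \<subseteq> carrier G - {\<zero>}" and t: "t \<le> card A"
  shows "card (close_collisions G t as) =
    (\<Sum>d\<in>{2..t}. \<Sum>i\<le>card A - d. of_bool (as \<in> zero_windows G A i d))"
proof -
  define S where "S = Sigma {2..t} (\<lambda>d. {i \<in> {..card A - d}. as \<in> zero_windows G A i d})"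
  have len: "length as = card A"
    using as by (rule length_finite_permutations_of_set)
  have c: "set as \<subseteq> carrier G" and nz: "\<zero> \<notin> set as"
    using as A by (auto simp: permutations_of_set_def)
  have "close_collisions G t as = (\<lambda>(d, i). (i, i + d)) ` S"
  proof (intro equalityI subsetI)
    fix x assume "x \<in> close_collisions G t as"
    then obtain i j where x: "x = (i, j)" "i < j" "j \<le> card A" "j - i \<le> t"
      "partial_sum G as i = partial_sum G as j"
      by (auto simp: close_collisions_def len)
    define d where "d = j - i"
    have j: "j = i + d" "d > 0"
      using x by (auto simp: d_def)
    have z: "window_sum G as i d = \<zero>"
      using partial_sum_eq_iff[OF c, of i d] x j len by simp
    have "d \<noteq> 1"
    proof
      assume "d = 1"
      then have "as ! i = \<zero>"
        using z window_sum_Suc[OF c, of i 0] x j len c by (auto simp: subset_iff)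
      moreover have "as ! i \<in> set as"
        using x len by simp
      ultimately show False
        using nz by simp
    qed
    then have "(d, i) \<in> S"
      using x j z as by (auto simp: S_def zero_windows_def)
    then show "x \<in> (\<lambda>(d, i). (i, i + d)) ` S"
      using x j by force
  next
    fix x assume "x \<in> (\<lambda>(d, i). (i, i + d)) ` S"
    then obtain d i where x: "x = (i, i + d)" "2 \<le> d" "d \<le> t" "i \<le> card A - d"
      "window_sum G as i d = \<zero>"
      by (auto simp: S_def zero_windows_def)
    then show "x \<in> close_collisions G t as"
      using partial_sum_eq_iff[OF c, of i d] t len by (auto simp: close_collisions_def)
  qed
  moreover have "inj_on (\<lambda>(d, i). (i, i + d)) S"
    by (auto simp: inj_on_def)
  ultimately have "card (close_collisions G t as) = card S"
    by (simp add: card_image)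
  also have "\<dots> = (\<Sum>d\<in>{2..t}. card {i \<in> {..card A - d}. as \<in> zero_windows G A i d})"
    unfolding S_def by (intro card_SigmaI) auto
  also have "\<dots> = (\<Sum>d\<in>{2..t}. \<Sum>i\<le>card A - d. of_bool (as \<in> zero_windows G A i d))"
    by (intro sum.cong refl card_Collect_eq_sum) simp
  finally show ?thesis .
qed

text \<open>Linearity of expectation in counted form: the sum over orderings is moved
  inside.\<close>

lemma sum_card_close_collisions:
  assumes "finite A" "A \<subseteq> carrier G - {\<zero>}" "t \<le> card A"
  shows "(\<Sum>as\<in>permutations_of_set A. card (close_collisions G t as)) =
    (\<Sum>d\<in>{2..t}. \<Sum>i\<le>card A - d. card (zero_windows G A i d))"
proof -
  have "(\<Sum>as\<in>permutations_of_set A. card (close_collisions G t as)) =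
    (\<Sum>as\<in>permutations_of_set A.
      \<Sum>d\<in>{2..t}. \<Sum>i\<le>card A - d. of_bool (as \<in> zero_windows G A i d))"
    using assms by (intro sum.cong refl card_close_collisions) auto
  also have "\<dots> = (\<Sum>d\<in>{2..t}. \<Sum>as\<in>permutations_of_set A.
      \<Sum>i\<le>card A - d. of_bool (as \<in> zero_windows G A i d))"
    by (rule sum.swap)
  also have "\<dots> = (\<Sum>d\<in>{2..t}. \<Sum>i\<le>card A - d. \<Sum>as\<in>permutations_of_set A.
      of_bool (as \<in> zero_windows G A i d))"
    by (rule sum.cong[OF refl], rule sum.swap)
  also have "\<dots> = (\<Sum>d\<in>{2..t}. \<Sum>i\<le>card A - d. card (zero_windows G A i d))"
  proof -
    have "zero_windows G A i d = {as \<in> permutations_of_set A. as \<in> zero_windows G A i d}" for i d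
      by (auto simp: zero_windows_def)
    then have "card (zero_windows G A i d) =
        (\<Sum>as\<in>permutations_of_set A. of_bool (as \<in> zero_windows G A i d))" for i d
      using card_Collect_eq_sum[of "permutations_of_set A" "\<lambda>as. as \<in> zero_windows G A i d"]
      by simp
    then show ?thesis
      by presburger
  qed
  finally show ?thesis .
qed

text \<open>
  Exchange the last entry of a zero window with any entry that is not among the first \<open>e\<close> of the
  window. These first \<open>e\<close> entries still determine the moved entry, so the exchange can be undone.
\<close>

lemma card_zero_windows_mult_le:
  assumes "finite A" "A \<subseteq> carrier G" "i + e < card A"
  shows "card (zero_windows G A i (Suc e)) * (card A - e) \<le>
    card {bs \<in> permutations_of_set A. \<ominus> window_sum G bs i e \<in> A - (!) bs ` {i..<i + e}}"
    (is "_ \<le> card ?T")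
proof -
  define p where "p = i + e"
  \<comment> \<open>The position \<open>p\<close> of the last window entry belongs to
    \<open>Q\<close>, which gives \<open>card A - e\<close> positions in all.\<close>
  define Q where "Q = {..<card A} - {i..<p}"
  have pQ: "p \<in> Q" "p < card A"
    using assms(3) by (auto simp: Q_def p_def)
  have card_Q: "card Q = card A - e"
  proof -
    have "{i..<p} \<subseteq> {..<card A}"
      using assms(3) by (auto simp: p_def)
    then show ?thesis
      by (simp add: Q_def p_def card_Diff_subset)
  qed
  have key: "swap_nth as p q \<in> permutations_of_set A \<and>
      swap_nth as p q ! q = \<ominus> window_sum G (swap_nth as p q) i e \<and>
      swap_nth (swap_nth as p q) p q = as"
    if "as \<in> zero_windows G A i (Suc e)" "q \<in> Q" for as q
  proof -
    have as: "as \<in> permutations_of_set A" "window_sum G as i (Suc e) = \<zero>"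
      using that by (auto simp: zero_windows_def)
    have len: "length as = card A"
      using as(1) by (rule length_finite_permutations_of_set)
    have c: "set as \<subseteq> carrier G"
      using as(1) assms(2) by (auto simp: permutations_of_set_def)
    have q: "q < card A" "q < i \<or> p \<le> q"
      using that by (auto simp: Q_def)
    have "as ! p \<oplus> window_sum G as i e = \<zero>"
      using as(2) window_sum_Suc[OF c, of i e] len pQ by (simp add: p_def)
    moreover have "as ! p \<in> carrier G"
      using c pQ len by auto
    ultimately have "as ! p = \<ominus> window_sum G as i e"
      using window_sum_closed[OF c, of i e] len assms(3) by (metis less_imp_le minus_equality)
    moreover have "swap_nth as p q ! q = as ! p"
      using q len by (simp add: swap_nth_def)
    moreover have "window_sum G (swap_nth as p q) i e = window_sum G as i e"
      using c len assms(3) q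
      by (intro window_sum_cong) (auto simp: swap_nth_def p_def nth_list_update)
    ultimately show ?thesis
      using swap_nth_permutations_of_set[OF as(1)] swap_nth_swap_nth[of p as q] len q pQ by simp
  qed
  have inj: "inj_on (\<lambda>(as, q). swap_nth as p q) (zero_windows G A i (Suc e) \<times> Q)"
  proof (rule inj_onI, clarify)
    fix as q as' q'
    assume *: "as \<in> zero_windows G A i (Suc e)" "q \<in> Q" "as' \<in> zero_windows G A i (Suc e)" "q' \<in> Q"
      "swap_nth as p q = swap_nth as' p q'"
    define bs where "bs = swap_nth as p q"
    \<comment> \<open>Both positions hold the same element, the negated sum of the first
      \<open>e\<close> window entries of \<open>bs\<close>. Entries are distinct, so the image
      determines \<open>q\<close>.\<close>
    have "bs ! q = bs ! q'" "bs \<in> permutations_of_set A"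
      using key[OF *(1,2)] key[OF *(3,4)] *(5) by (simp_all add: bs_def)
    moreover have "q < card A" "q' < card A"
      using * by (auto simp: Q_def)
    ultimately have "q = q'"
      by (metis length_finite_permutations_of_set nth_eq_iff_index_eq permutations_of_setD(2))
    then show "as = as' \<and> q = q'"
      using key[OF *(1,2)] key[OF *(3,4)] *(5) by metis
  qed
  have img: "(\<lambda>(as, q). swap_nth as p q) ` (zero_windows G A i (Suc e) \<times> Q) \<subseteq> ?T"
  proof clarify
    fix as q assume *: "as \<in> zero_windows G A i (Suc e)" "q \<in> Q"
    define bs where "bs = swap_nth as p q"
    have bs: "bs \<in> permutations_of_set A" "bs ! q = \<ominus> window_sum G bs i e"
      using key[OF *] by (simp_all add: bs_def)
    have len: "length bs = card A" and "distinct bs" "set bs = A"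
      using bs(1) by (auto simp: permutations_of_set_def distinct_card)
    moreover have "q < card A" "q \<notin> {i..<i + e}"
      using * by (auto simp: Q_def p_def)
    ultimately have "bs ! q \<in> A - (!) bs ` {i..<i + e}"
      using assms(3) by (auto simp: nth_eq_iff_index_eq)
    then show "bs \<in> permutations_of_set A \<and>
        \<ominus> window_sum G bs i e \<in> A - (!) bs ` {i..<i + e}"
      using bs by simp
  qed
  have "card (zero_windows G A i (Suc e)) * (card A - e) = card (zero_windows G A i (Suc e) \<times> Q)"
    by (simp add: card_cartesian_product card_Q)
  also have "\<dots> \<le> card ?T"
    using assms(1) by (intro card_inj_on_le[OF inj img]) auto
  finally show ?thesis .
qed

section \<open>Averages over window positions and lengths\<close>

lemma card_zero_windows_le:
  assumes "finite A" "A \<subseteq> carrier G" "i + e < card A"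
  shows "card (zero_windows G A i (Suc e)) * (card A - e) \<le> fact (card A)"
proof -
  have "card (zero_windows G A i (Suc e)) * (card A - e) \<le> card (permutations_of_set A)"
    using assms(1) by (intro order_trans[OF card_zero_windows_mult_le[OF assms]] card_mono) auto
  then show ?thesis
    using assms(1) by simp
qed

text \<open>The number of positions, \<open>card A - d + 1\<close>, equals the factor in the bound
  for a single window, so the two cancel.\<close>

lemma sum_card_zero_windows_le:
  assumes "finite A" "A \<subseteq> carrier G" "d \<ge> 1" "d \<le> card A"
  shows "(\<Sum>i\<le>card A - d. card (zero_windows G A i d)) \<le> fact (card A)"
proof -
  obtain e where d: "d = Suc e"
    using assms(3) by (cases d) auto
  have k: "card A - e = Suc (card A - d)"
    using assms(4) d by simp
  have "(\<Sum>i\<le>card A - d. card (zero_windows G A i d)) * (card A - e) =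
      (\<Sum>i\<le>card A - d. card (zero_windows G A i d) * (card A - e))"
    by (simp add: sum_distrib_right)
  also have "\<dots> \<le> (\<Sum>i\<le>card A - d. fact (card A))"
    unfolding d using assms d by (intro sum_mono card_zero_windows_le) auto
  also have "\<dots> = fact (card A) * (card A - e)"
    by (simp add: k)
  finally show ?thesis
    by (simp add: k del: mult_Suc_right)
qed

text \<open>No new entry completes the first \<open>e\<close> entries of \<open>bs\<close> to a zero
  sum, so \<open>bs\<close> lies outside the target of the exchange at position 0. That one count is
  strict, hence so is the sum.\<close>

lemma sum_card_zero_windows_less:
  assumes "finite A" "A \<subseteq> carrier G" "Suc e \<le> card A" "bs \<in> permutations_of_set A"
    and "\<ominus> window_sum G bs 0 e \<notin> A - (!) bs ` {..<e}"
  shows "(\<Sum>i\<le>card A - Suc e. card (zero_windows G A i (Suc e))) < fact (card A)"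
proof -
  have k: "card A - e = Suc (card A - Suc e)"
    using assms(3) by simp
  have "card (zero_windows G A 0 (Suc e)) * (card A - e) < card (permutations_of_set A)"
    using assms
    by (intro le_less_trans[OF card_zero_windows_mult_le] psubset_card_mono)
      (auto simp: lessThan_atLeast0)
  then have less: "card (zero_windows G A 0 (Suc e)) * (card A - e) < fact (card A)"
    using assms(1) by simp
  have "(\<Sum>i\<le>card A - Suc e. card (zero_windows G A i (Suc e))) * (card A - e) =
      (\<Sum>i\<le>card A - Suc e. card (zero_windows G A i (Suc e)) * (card A - e))"
    by (simp add: sum_distrib_right)
  also have "\<dots> < (\<Sum>i\<le>card A - Suc e. fact (card A))"
    using assms less
    by (intro sum_strict_mono_ex1 ballI card_zero_windows_le bexI[of _ 0]) auto
  also have "\<dots> = fact (card A) * (card A - e)"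
    by (simp add: k)
  finally show ?thesis
    by simp
qed

text \<open>Each of the \<open>t - 1\<close> lengths contributes at most
  \<open>fact (card A)\<close>, and the length \<open>Suc e\<close> contributes strictly
  less.\<close>

lemma sum_card_close_collisions_less:
  assumes "finite A" "A \<subseteq> carrier G - {\<zero>}" "t \<le> card A" "2 \<le> Suc e" "Suc e \<le> t"
    and "bs \<in> permutations_of_set A" "\<ominus> window_sum G bs 0 e \<notin> A - (!) bs ` {..<e}"
  shows "(\<Sum>as\<in>permutations_of_set A. card (close_collisions G t as)) < fact (card A) * (t - 1)"
proof -
  have "(\<Sum>as\<in>permutations_of_set A. card (close_collisions G t as)) =
      (\<Sum>d\<in>{2..t}. \<Sum>i\<le>card A - d. card (zero_windows G A i d))"
    using assms by (intro sum_card_close_collisions)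
  also have "\<dots> < (\<Sum>d\<in>{2..t}. fact (card A))"
  proof (intro sum_strict_mono_ex1 ballI bexI[of _ "Suc e"])
    show "(\<Sum>i\<le>card A - Suc e. card (zero_windows G A i (Suc e))) < fact (card A)"
      using assms by (intro sum_card_zero_windows_less[of _ _ bs]) auto
  next
    fix d assume "d \<in> {2..t}"
    then show "(\<Sum>i\<le>card A - d. card (zero_windows G A i d)) \<le> fact (card A)"
      using assms by (intro sum_card_zero_windows_le) auto
  qed (use assms in auto)
  finally show ?thesis
    by (simp add: mult.commute)
qed

section \<open>Exclusion of equality\<close>

text \<open>Each opposite pair returns the partial sum to its earlier value, so the partial sums at
  0, 2 and 4 agree.\<close>

lemma two_le_card_close_collisions:
  assumes "set as \<subseteq> carrier G" "4 \<le> length as" "2 \<le> t"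
    and "as ! 1 = \<ominus> (as ! 0)" "as ! 3 = \<ominus> (as ! 2)"
  shows "2 \<le> card (close_collisions G t as)"
proof -
  have "finite (close_collisions G t as)"
    by (rule finite_subset[of _ "{..length as} \<times> {..length as}"]) (auto simp: close_collisions_def)
  moreover have "partial_sum G as 0 = partial_sum G as 2"
    using assms zero_window_pair_iff[of as 0] partial_sum_eq_iff[of as 0 2]
    by (simp add: numeral_2_eq_2)
  moreover have "partial_sum G as 2 = partial_sum G as 4"
    using assms zero_window_pair_iff[of as 2] partial_sum_eq_iff[of as 2 2] by simp
  ultimately have "finite (close_collisions G t as)"
      and "{(0, 2), (2, 4)} \<subseteq> close_collisions G t as"
    using assms(2,3) by (simp_all add: close_collisions_def)
  then have "card {(0::nat, 2::nat), (2, 4)} \<le> card (close_collisions G t as)"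
    by (intro card_mono)
  then show ?thesis
    by simp
qed

theorem ex_ordering_few_close_collisions:
  assumes "A \<subseteq> carrier G - {\<zero>}" "2 \<le> t" "t < card A"
  shows "\<exists>as \<in> permutations_of_set A. card (close_collisions G t as) < t - 1"
proof (rule ccontr)
  assume "\<not> ?thesis"
  then have many: "t - 1 \<le> card (close_collisions G t as)" if "as \<in> permutations_of_set A" for as
    using that by (meson not_le)
  have fin: "finite A"
    using assms(3) by (metis card.infinite not_less0)
  have "fact (card A) * (t - 1) = (\<Sum>as\<in>permutations_of_set A. t - 1)"
    using fin by simp
  also have "\<dots> \<le> (\<Sum>as\<in>permutations_of_set A. card (close_collisions G t as))"
    using many by (rule sum_mono)
  \<comment> \<open>From here on, any ordering that makes the average strict yields a
    contradiction.\<close>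
  finally have ge: "\<not> (\<Sum>as\<in>permutations_of_set A. card (close_collisions G t as)) <
      fact (card A) * (t - 1)"
    by simp
  \<comment> \<open>Otherwise the only entry completing \<open>a\<close> to a zero pair is missing
    from \<open>A\<close> or is \<open>a\<close> itself, already used; this gives strictness at
    length 2.\<close>
  have sym: "\<ominus> a \<in> A \<and> a \<noteq> \<ominus> a" if a: "a \<in> A" for a
  proof (rule ccontr)
    assume *: "\<not> ?thesis"
    obtain ys where bs: "[a] @ ys \<in> permutations_of_set A"
      using permutations_of_set_extend[of A "[a]"] fin a by auto
    have c: "set ([a] @ ys) \<subseteq> carrier G"
      using bs assms(1) by (auto simp: permutations_of_set_def)
    have "window_sum G ([a] @ ys) 0 1 = a"
      using window_sum_Suc[OF c, of 0 0] c by simp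
    then have "\<ominus> window_sum G ([a] @ ys) 0 1 \<notin> A - (!) ([a] @ ys) ` {..<1}"
      using * by auto
    then show False
      using sum_card_close_collisions_less[OF fin assms(1), of t 1] ge bs assms by auto
  qed
  obtain a where a: "a \<in> A"
    using assms(3) by fastforce
  note sa = sym[OF a]
  show False
  proof (cases "t = 2")
    case False
    obtain ys where bs: "[a, \<ominus> a] @ ys \<in> permutations_of_set A"
      using permutations_of_set_extend[of A "[a, \<ominus> a]"] fin a sa by auto
    have c: "set ([a, \<ominus> a] @ ys) \<subseteq> carrier G"
      using bs assms(1) by (auto simp: permutations_of_set_def)
    have "window_sum G ([a, \<ominus> a] @ ys) 0 2 = \<zero>"
      using zero_window_pair_iff[OF c, of 0] by simp
    then have "\<ominus> window_sum G ([a, \<ominus> a] @ ys) 0 2 \<notin> A - (!) ([a, \<ominus> a] @ ys) ` {..<2}"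
      using assms(1) by auto
    then show False
      \<comment> \<open>The argument \<open>2\<close> is \<open>e\<close>, so the window length is
        3, available since \<open>t\<close> is not 2.\<close>
      using sum_card_close_collisions_less[OF fin assms(1), of t 2] ge bs assms False by auto
  next
    case True
    have "\<not> A \<subseteq> {a, \<ominus> a}"
    proof
      assume "A \<subseteq> {a, \<ominus> a}"
      then have "card A \<le> card {a, \<ominus> a}"
        by (intro card_mono) auto
      also have "\<dots> \<le> 2"
        by (simp add: card_insert_if)
      finally show False
        using assms by simp
    qed
    then obtain b where b: "b \<in> A" "b \<noteq> a" "b \<noteq> \<ominus> a"
      by auto
    note sb = sym[OF b(1)]
    \<comment> \<open>Negating either equality would put \<open>b\<close> among \<open>a\<close> and
      \<open>\<ominus> a\<close>.\<close>
    have "\<ominus> b \<noteq> a" "\<ominus> b \<noteq> \<ominus> a"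
      using a b assms(1) by (metis DiffE minus_minus subsetD)+
    then have "set [a, \<ominus> a, b, \<ominus> b] \<subseteq> A" "distinct [a, \<ominus> a, b, \<ominus> b]"
      using a b sa sb by auto
    then obtain ys where bs: "[a, \<ominus> a, b, \<ominus> b] @ ys \<in> permutations_of_set A"
      using permutations_of_set_extend[OF fin] by metis
    have "set ([a, \<ominus> a, b, \<ominus> b] @ ys) \<subseteq> carrier G"
      using bs assms(1) by (auto simp: permutations_of_set_def)
    then have two: "2 \<le> card (close_collisions G t ([a, \<ominus> a, b, \<ominus> b] @ ys))"
      using assms by (intro two_le_card_close_collisions) auto
    \<comment> \<open>Every ordering has at least \<open>t - 1 = 1\<close> collision and this one
      has two, so the total exceeds what the single length 2 can contribute.\<close>
    have "fact (card A) = (\<Sum>as\<in>permutations_of_set A. 1::nat)"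
      using fin by simp
    also have "\<dots> < (\<Sum>as\<in>permutations_of_set A. card (close_collisions G t as))"
      using many two bs fin True
      by (intro sum_strict_mono_ex1 ballI bexI[of _ "[a, \<ominus> a, b, \<ominus> b] @ ys"]) fastforce+
    also have "\<dots> = (\<Sum>i\<le>card A - 2. card (zero_windows G A i 2))"
      using sum_card_close_collisions[OF fin assms(1), of t] assms True by simp
    also have "\<dots> \<le> fact (card A)"
      using fin assms by (intro sum_card_zero_windows_le) auto
    finally show False
      by simp
  qed
qed

end

theorem theorem4p5:
  fixes n t :: nat and A :: "int set"
  assumes "n > 0"
    and "A \<subseteq> carrier (residue_ring (int n)) - {\<zero>\<^bsub>residue_ring (int n)\<^esub>}"
    and "2 \<le> t" and "t < card A"
  shows "\<exists>as \<in> permutations_of_set A.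
           card (close_collisions (residue_ring (int n)) t as) < t - 1"
proof -
  \<comment> \<open>The locale \<open>residues\<close> needs a modulus above 1. For modulus 1 there
    are no nonzero residues.\<close>
  have "n \<noteq> 1"
  proof
    assume "n = 1"
    then have "A = {}"
      using assms(2) by (auto simp: residue_ring_def)
    then show False
      using assms(4) by simp
  qed
  then interpret residues "int n" "residue_ring (int n)"
    using assms(1) by unfold_locales auto
  show ?thesis
    using assms(2-4) by (rule ex_ordering_few_close_collisions)
qed

end
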